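(* The inclusion functor $F\colon\mathbf{sELeib}\to\mathbf{ELeib}$ from the category of symmetric enhanced Leibniz algebras to the category of enhanced Leibniz algebras is an equivalence of categories.
   Context: All vector spaces are over a field $\mathbb{K}$ of characteristic different from $2$. A (left) Leibniz algebra $(\mathbb{V},[\cdot,\cdot])$ is a vector space with a bilinear bracket satisfying $[v_1,[v_2,v_3]]=[[v_1,v_2],v_3]+[v_2,[v_1,v_3]]$. An enhanced Leibniz algebra (ELA) $(t\colon\mathbb{W}\to\mathbb{V},[\cdot,\cdot],\circ)$ consists of a left Leibniz algebra $(\mathbb{V},[\cdot,\cdot])$, a vector space $\mathbb{W}$, a linear map $t\colon\mathbb{W}\to\mathbb{V}$, and a bilinear product $\circ\colon\mathbb{V}\times\mathbb{V}\to\mathbb{W}$ such that for all $u,v\in\mathbb{V}$, $w\in\mathbb{W}$: (a) $[t(w),v]=0$; (b) $t(w)\circ t(w)=0$; (c) $u\stackrel{s}{\circ}[v,v]=v\stackrel{s}{\circ}[u,v]$; (d) $[v,v]=t(v\circ v)$; here $u\stackrel{s}{\circ}v:=\tfrac12(u\circ v+v\circ u)$. It is symmetric (an sELA) if $\circ$ is symmetric. A plain morphism $(\varphi,\psi)$ from $(t\colon\mathbb{W}\to\mathbb{V},[\cdot,\cdot],\circ)$ to $(t'\colon\mathbb{W}'\to\mathbb{V}',[\cdot,\cdot]',\circ')$ is a pair of linear maps $\varphi\colon\mathbb{W}\to\mathbb{W}'$, $\psi\colon\mathbb{V}\to\mathbb{V}'$ with $\psi\circ t=t'\circ\varphi$,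 $\psi$ a morphism of Leibniz algebras, and $\psi(v_1)\circ'\psi(v_2)=\varphi(v_1\circ v_2)$ for all $v_1,v_2\in\mathbb{V}$. For an alternating bilinear map $\beta\colon\mathbb{V}\times\mathbb{V}\to\mathbb{W}$, the $\beta$-transformation goes from $(t,[\cdot,\cdot],\circ)$ to the ELA $(t,[\cdot,\cdot],\circ+\beta(\cdot,\cdot))$, with identity underlying linear maps on $\mathbb{W}$ and $\mathbb{V}$. $\mathbf{ELeib}$: objects are ELAs; morphisms are generated by plain morphisms and $\beta$-transformations, i.e. they are finite composites of these, regarded as equal when source, target and underlying pairs of linear maps agree. $\mathbf{sELeib}$: objects are sELAs; morphisms are the plain morphisms only. *)

theory Defs
  imports "HOL-Library.FuncSet" "Jordan_Normal_Form.Missing_VectorSpace"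
begin

section \<open>Categories, functors, equivalences\<close>

record ('o, 'a) cat =
  Obj :: "'o set"
  Arr :: "'a set"
  Dom :: "'a \<Rightarrow> 'o"
  Cod :: "'a \<Rightarrow> 'o"
  Idt :: "'o \<Rightarrow> 'a"
  Cmp :: "'a \<Rightarrow> 'a \<Rightarrow> 'a"  \<comment> \<open>\<open>Cmp C g f\<close> is "\<open>g\<close> after \<open>f\<close>"\<close>

definition in_hom :: "('o, 'a) cat \<Rightarrow> 'a \<Rightarrow> 'o \<Rightarrow> 'o \<Rightarrow> bool" where
  "in_hom C f A B \<longleftrightarrow> f \<in> Arr C \<and> Dom C f = A \<and> Cod C f = B"

definition is_category :: "('o, 'a) cat \<Rightarrow> bool" where
  "is_category C \<longleftrightarrow>
     (\<forall>f\<in>Arr C. Dom C f \<in> Obj C \<and> Cod C f \<in> Obj C) \<and>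
     (\<forall>A\<in>Obj C. in_hom C (Idt C A) A A) \<and>
     (\<forall>f\<in>Arr C. \<forall>g\<in>Arr C. Dom C g = Cod C f \<longrightarrow> in_hom C (Cmp C g f) (Dom C f) (Cod C g)) \<and>
     (\<forall>f\<in>Arr C. Cmp C f (Idt C (Dom C f)) = f \<and> Cmp C (Idt C (Cod C f)) f = f) \<and>
     (\<forall>f\<in>Arr C. \<forall>g\<in>Arr C. \<forall>h\<in>Arr C. Dom C g = Cod C f \<and> Dom C h = Cod C g \<longrightarrow>
        Cmp C h (Cmp C g f) = Cmp C (Cmp C h g) f)"

record ('o, 'a, 'p, 'b) func =
  onObj :: "'o \<Rightarrow> 'p"
  onArr :: "'a \<Rightarrow> 'b"

definition is_functor ::
    "('o, 'a) cat \<Rightarrow> ('p, 'b) cat \<Rightarrow> ('o, 'a, 'p, 'b) func \<Rightarrow> bool" where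
  "is_functor C D F \<longleftrightarrow>
     is_category C \<and> is_category D \<and>
     (\<forall>A\<in>Obj C. onObj F A \<in> Obj D) \<and>
     (\<forall>f\<in>Arr C. in_hom D (onArr F f) (onObj F (Dom C f)) (onObj F (Cod C f))) \<and>
     (\<forall>A\<in>Obj C. onArr F (Idt C A) = Idt D (onObj F A)) \<and>
     (\<forall>f\<in>Arr C. \<forall>g\<in>Arr C. Dom C g = Cod C f \<longrightarrow>
        onArr F (Cmp C g f) = Cmp D (onArr F g) (onArr F f))"

definition func_id :: "('o, 'a, 'o, 'a) func" where
  "func_id = \<lparr>onObj = (\<lambda>A. A), onArr = (\<lambda>f. f)\<rparr>"

definition func_comp ::
    "('p, 'b, 'q, 'c) func \<Rightarrow> ('o, 'a, 'p, 'b) func \<Rightarrow> ('o, 'a, 'q, 'c) func" where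
  "func_comp G F = \<lparr>onObj = (\<lambda>A. onObj G (onObj F A)), onArr = (\<lambda>f. onArr G (onArr F f))\<rparr>"

definition natural_transformation ::
    "('o, 'a) cat \<Rightarrow> ('p, 'b) cat \<Rightarrow> ('o, 'a, 'p, 'b) func \<Rightarrow> ('o, 'a, 'p, 'b) func
      \<Rightarrow> ('o \<Rightarrow> 'b) \<Rightarrow> bool" where
  "natural_transformation C D F G \<eta> \<longleftrightarrow>
     is_functor C D F \<and> is_functor C D G \<and>
     (\<forall>A\<in>Obj C. in_hom D (\<eta> A) (onObj F A) (onObj G A)) \<and>
     (\<forall>f\<in>Arr C. Cmp D (\<eta> (Cod C f)) (onArr F f) = Cmp D (onArr G f) (\<eta> (Dom C f)))"

definition is_iso :: "('o, 'a) cat \<Rightarrow> 'a \<Rightarrow> bool" where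
  "is_iso C f \<longleftrightarrow> f \<in> Arr C \<and>
     (\<exists>g. in_hom C g (Cod C f) (Dom C f) \<and>
          Cmp C g f = Idt C (Dom C f) \<and> Cmp C f g = Idt C (Cod C f))"

definition naturally_isomorphic ::
    "('o, 'a) cat \<Rightarrow> ('p, 'b) cat \<Rightarrow> ('o, 'a, 'p, 'b) func \<Rightarrow> ('o, 'a, 'p, 'b) func \<Rightarrow> bool" where
  "naturally_isomorphic C D F G \<longleftrightarrow>
     (\<exists>\<eta>. natural_transformation C D F G \<eta> \<and> (\<forall>A\<in>Obj C. is_iso D (\<eta> A)))"

definition is_equivalence ::
    "('o, 'a) cat \<Rightarrow> ('p, 'b) cat \<Rightarrow> ('o, 'a, 'p, 'b) func \<Rightarrow> bool" where
  "is_equivalence C D F \<longleftrightarrow>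
     is_functor C D F \<and>
     (\<exists>G. is_functor D C G \<and>
          naturally_isomorphic C C (func_comp G F) func_id \<and>
          naturally_isomorphic D D (func_comp F G) func_id)"

text \<open>The inclusion of a subcategory is the identity on objects and arrows; that objects and
  arrows of the source really belong to the target is part of \<^const>\<open>is_functor\<close>.\<close>

definition inclusion_functor :: "('o, 'a, 'o, 'a) func" where
  "inclusion_functor = \<lparr>onObj = (\<lambda>A. A), onArr = (\<lambda>f. f)\<rparr>"


section \<open>Enhanced Leibniz algebras\<close>

text \<open>
  Vector spaces have an arbitrary carrier inside a type, so the types \<open>'v\<close> and \<open>'w\<close> play the role
  of the universes from which the spaces \<open>V\<close> and \<open>W\<close> are drawn. The ring multiplication and unit
  components of the module records are ignored, as usual for modules in HOL-Algebra.

  All maps are required to be extensional (\<open>undefined\<close> outside the carriers), so that equality of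
  maps in HOL is equality of the maps on the vector spaces.
\<close>

definition linear_maps ::
    "('k, 'm) ring_scheme \<Rightarrow> ('k, 'a) module \<Rightarrow> ('k, 'b) module \<Rightarrow> ('a \<Rightarrow> 'b) set" where
  "linear_maps K M N = module_hom K M N \<inter> extensional (carrier M)"

definition bilinear_maps ::
    "('k, 'm) ring_scheme \<Rightarrow> ('k, 'a) module \<Rightarrow> ('k, 'b) module \<Rightarrow> ('k, 'c) module
      \<Rightarrow> ('a \<Rightarrow> 'b \<Rightarrow> 'c) set" where
  "bilinear_maps K M N P =
     {f \<in> carrier M \<rightarrow>\<^sub>E carrier N \<rightarrow>\<^sub>E carrier P.
        (\<forall>x\<in>carrier M. (\<lambda>y. f x y) \<in> module_hom K N P) \<and>
        (\<forall>y\<in>carrier N. (\<lambda>x. f x y) \<in> module_hom K M P)}"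

definition alternating_maps ::
    "('k, 'm) ring_scheme \<Rightarrow> ('k, 'a) module \<Rightarrow> ('k, 'c) module \<Rightarrow> ('a \<Rightarrow> 'a \<Rightarrow> 'c) set" where
  "alternating_maps K M P =
     {\<beta> \<in> bilinear_maps K M M P. \<forall>x\<in>carrier M. \<beta> x x = \<zero>\<^bsub>P\<^esub>}"

definition leibniz_algebra ::
    "('k, 'm) ring_scheme \<Rightarrow> ('k, 'v) module \<Rightarrow> ('v \<Rightarrow> 'v \<Rightarrow> 'v) \<Rightarrow> bool" where
  "leibniz_algebra K V b \<longleftrightarrow>
     vectorspace K V \<and> b \<in> bilinear_maps K V V V \<and>
     (\<forall>v1\<in>carrier V. \<forall>v2\<in>carrier V. \<forall>v3\<in>carrier V.
        b v1 (b v2 v3) = b (b v1 v2) v3 \<oplus>\<^bsub>V\<^esub> b v2 (b v1 v3))"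

record ('k, 'w, 'v) ela_data =
  wsp :: "('k, 'w) module"
  vsp :: "('k, 'v) module"
  tmap :: "'w \<Rightarrow> 'v"
  brk :: "'v \<Rightarrow> 'v \<Rightarrow> 'v"
  circ :: "'v \<Rightarrow> 'v \<Rightarrow> 'w"

definition circ_sym ::
    "('k, 'm) ring_scheme \<Rightarrow> ('k, 'w, 'v) ela_data \<Rightarrow> 'v \<Rightarrow> 'v \<Rightarrow> 'w" where
  "circ_sym K A u v =
     (inv\<^bsub>K\<^esub> (\<one>\<^bsub>K\<^esub> \<oplus>\<^bsub>K\<^esub> \<one>\<^bsub>K\<^esub>)) \<odot>\<^bsub>wsp A\<^esub> (circ A u v \<oplus>\<^bsub>wsp A\<^esub> circ A v u)"

definition is_ELA :: "('k, 'm) ring_scheme \<Rightarrow> ('k, 'w, 'v) ela_data \<Rightarrow> bool" where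
  "is_ELA K A \<longleftrightarrow>
     leibniz_algebra K (vsp A) (brk A) \<and>
     vectorspace K (wsp A) \<and>
     tmap A \<in> linear_maps K (wsp A) (vsp A) \<and>
     circ A \<in> bilinear_maps K (vsp A) (vsp A) (wsp A) \<and>
     (\<forall>w\<in>carrier (wsp A). \<forall>v\<in>carrier (vsp A). brk A (tmap A w) v = \<zero>\<^bsub>vsp A\<^esub>) \<and>
     (\<forall>w\<in>carrier (wsp A). circ A (tmap A w) (tmap A w) = \<zero>\<^bsub>wsp A\<^esub>) \<and>
     (\<forall>u\<in>carrier (vsp A). \<forall>v\<in>carrier (vsp A).
        circ_sym K A u (brk A v v) = circ_sym K A v (brk A u v)) \<and>
     (\<forall>v\<in>carrier (vsp A). brk A v v = tmap A (circ A v v))"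

definition is_sELA :: "('k, 'm) ring_scheme \<Rightarrow> ('k, 'w, 'v) ela_data \<Rightarrow> bool" where
  "is_sELA K A \<longleftrightarrow> is_ELA K A \<and>
     (\<forall>u\<in>carrier (vsp A). \<forall>v\<in>carrier (vsp A). circ A u v = circ A v u)"


section \<open>Morphisms\<close>

text \<open>A morphism records source, target and the underlying pair \<open>(\<phi>, \<psi>)\<close>, so that equality of
  these records is the prescribed equality of morphisms.\<close>

record ('k, 'w, 'v) ela_mor =
  src :: "('k, 'w, 'v) ela_data"
  tgt :: "('k, 'w, 'v) ela_data"
  wmap :: "'w \<Rightarrow> 'w"
  vmap :: "'v \<Rightarrow> 'v"

definition ela_id :: "('k, 'w, 'v) ela_data \<Rightarrow> ('k, 'w, 'v) ela_mor" where
  "ela_id A = \<lparr>src = A, tgt = A,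
     wmap = (\<lambda>w\<in>carrier (wsp A). w), vmap = (\<lambda>v\<in>carrier (vsp A). v)\<rparr>"

definition ela_comp ::
    "('k, 'w, 'v) ela_mor \<Rightarrow> ('k, 'w, 'v) ela_mor \<Rightarrow> ('k, 'w, 'v) ela_mor" where
  "ela_comp g f = \<lparr>src = src f, tgt = tgt g,
     wmap = compose (carrier (wsp (src f))) (wmap g) (wmap f),
     vmap = compose (carrier (vsp (src f))) (vmap g) (vmap f)\<rparr>"

definition is_plain_morphism :: "('k, 'm) ring_scheme \<Rightarrow> ('k, 'w, 'v) ela_mor \<Rightarrow> bool" where
  "is_plain_morphism K f \<longleftrightarrow>
     (let A = src f; A' = tgt f; \<phi> = wmap f; \<psi> = vmap f in
        is_ELA K A \<and> is_ELA K A' \<and>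
        \<phi> \<in> linear_maps K (wsp A) (wsp A') \<and>
        \<psi> \<in> linear_maps K (vsp A) (vsp A') \<and>
        (\<forall>w\<in>carrier (wsp A). \<psi> (tmap A w) = tmap A' (\<phi> w)) \<and>
        (\<forall>v1\<in>carrier (vsp A). \<forall>v2\<in>carrier (vsp A).
           \<psi> (brk A v1 v2) = brk A' (\<psi> v1) (\<psi> v2)) \<and>
        (\<forall>v1\<in>carrier (vsp A). \<forall>v2\<in>carrier (vsp A).
           circ A' (\<psi> v1) (\<psi> v2) = \<phi> (circ A v1 v2)))"

definition beta_target ::
    "('k, 'w, 'v) ela_data \<Rightarrow> ('v \<Rightarrow> 'v \<Rightarrow> 'w) \<Rightarrow> ('k, 'w, 'v) ela_data" where
  "beta_target A \<beta> =
     A\<lparr>circ := (\<lambda>u\<in>carrier (vsp A). \<lambda>v\<in>carrier (vsp A). circ A u v \<oplus>\<^bsub>wsp A\<^esub> \<beta> u v)\<rparr>"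

definition beta_transformation ::
    "('k, 'w, 'v) ela_data \<Rightarrow> ('v \<Rightarrow> 'v \<Rightarrow> 'w) \<Rightarrow> ('k, 'w, 'v) ela_mor" where
  "beta_transformation A \<beta> = \<lparr>src = A, tgt = beta_target A \<beta>,
     wmap = (\<lambda>w\<in>carrier (wsp A). w), vmap = (\<lambda>v\<in>carrier (vsp A). v)\<rparr>"

inductive_set ELeib_morphisms :: "('k, 'm) ring_scheme \<Rightarrow> ('k, 'w, 'v) ela_mor set"
  for K :: "('k, 'm) ring_scheme" where
  plain: "is_plain_morphism K f \<Longrightarrow> f \<in> ELeib_morphisms K"
| beta: "is_ELA K A \<Longrightarrow> \<beta> \<in> alternating_maps K (vsp A) (wsp A) \<Longrightarrow>
    beta_transformation A \<beta> \<in> ELeib_morphisms K"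
| comp: "f \<in> ELeib_morphisms K \<Longrightarrow> g \<in> ELeib_morphisms K \<Longrightarrow> src g = tgt f \<Longrightarrow>
    ela_comp g f \<in> ELeib_morphisms K"

definition ELeib ::
    "('k, 'm) ring_scheme \<Rightarrow> (('k, 'w, 'v) ela_data, ('k, 'w, 'v) ela_mor) cat" where
  "ELeib K = \<lparr>Obj = {A. is_ELA K A}, Arr = ELeib_morphisms K,
     Dom = src, Cod = tgt, Idt = ela_id, Cmp = ela_comp\<rparr>"

definition sELeib ::
    "('k, 'm) ring_scheme \<Rightarrow> (('k, 'w, 'v) ela_data, ('k, 'w, 'v) ela_mor) cat" where
  "sELeib K = \<lparr>Obj = {A. is_sELA K A},
     Arr = {f. is_plain_morphism K f \<and> is_sELA K (src f) \<and> is_sELA K (tgt f)},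
     Dom = src, Cod = tgt, Idt = ela_id, Cmp = ela_comp\<rparr>"

end

theory Submission
  imports Defs
begin

text \<open>
  A change of \<open>\<circ>\<close> by an alternating form is invisible to the quadratic map \<open>v \<mapsto> v \<circ> v\<close>, and by
  polarization this map determines the symmetric part of \<open>\<circ>\<close>. Hence every morphism of
  \<open>ELeib\<close> preserves the quadratic maps and so becomes a plain morphism between the
  symmetrized algebras. Symmetrization is therefore a functor to \<open>sELeib\<close>; it fixes symmetric
  algebras, and the \<open>\<beta>\<close>-transformation with \<open>\<beta> = \<circ> - \<circ>\<^sup>s\<close> is a natural isomorphism from
  the symmetrization of an algebra to the algebra itself.
\<close>

section \<open>Linear and bilinear maps\<close>

lemma linear_mapsD:
  assumes "f \<in> linear_maps K M N"
  shows "f \<in> carrier M \<rightarrow> carrier N" "f \<in> extensional (carrier M)"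
    "\<And>x. x \<in> carrier M \<Longrightarrow> f x \<in> carrier N"
    "\<And>x y. x \<in> carrier M \<Longrightarrow> y \<in> carrier M \<Longrightarrow> f (x \<oplus>\<^bsub>M\<^esub> y) = f x \<oplus>\<^bsub>N\<^esub> f y"
    "\<And>a x. a \<in> carrier K \<Longrightarrow> x \<in> carrier M \<Longrightarrow> f (a \<odot>\<^bsub>M\<^esub> x) = a \<odot>\<^bsub>N\<^esub> f x"
  using assms by (auto simp: linear_maps_def module_hom_def)

lemma linear_maps_id:
  assumes "module K M"
  shows "(\<lambda>x\<in>carrier M. x) \<in> linear_maps K M M"
proof -
  interpret module K M by fact
  show ?thesis by (auto simp: linear_maps_def module_hom_def)
qed

lemma linear_maps_compose:
  assumes "module K M" "f \<in> linear_maps K M N" "g \<in> linear_maps K N P"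
  shows "compose (carrier M) g f \<in> linear_maps K M P"
proof -
  interpret module K M by fact
  note f = linear_mapsD[OF assms(2)] and g = linear_mapsD[OF assms(3)]
  show ?thesis
    by (auto simp: linear_maps_def module_hom_def compose_def f g)
qed

lemma bilinear_mapsD:
  assumes "f \<in> bilinear_maps K M N P"
  shows "f \<in> carrier M \<rightarrow>\<^sub>E carrier N \<rightarrow>\<^sub>E carrier P"
    "\<And>x y. x \<in> carrier M \<Longrightarrow> y \<in> carrier N \<Longrightarrow> f x y \<in> carrier P"
    "\<And>x x' y. x \<in> carrier M \<Longrightarrow> x' \<in> carrier M \<Longrightarrow> y \<in> carrier N \<Longrightarrow>
      f (x \<oplus>\<^bsub>M\<^esub> x') y = f x y \<oplus>\<^bsub>P\<^esub> f x' y"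
    "\<And>x y y'. x \<in> carrier M \<Longrightarrow> y \<in> carrier N \<Longrightarrow> y' \<in> carrier N \<Longrightarrow>
      f x (y \<oplus>\<^bsub>N\<^esub> y') = f x y \<oplus>\<^bsub>P\<^esub> f x y'"
    "\<And>a x y. a \<in> carrier K \<Longrightarrow> x \<in> carrier M \<Longrightarrow> y \<in> carrier N \<Longrightarrow>
      f (a \<odot>\<^bsub>M\<^esub> x) y = a \<odot>\<^bsub>P\<^esub> f x y"
    "\<And>a x y. a \<in> carrier K \<Longrightarrow> x \<in> carrier M \<Longrightarrow> y \<in> carrier N \<Longrightarrow>
      f x (a \<odot>\<^bsub>N\<^esub> y) = a \<odot>\<^bsub>P\<^esub> f x y"
  using assms by (auto simp: bilinear_maps_def module_hom_def)

lemma bilinear_maps_eqI: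
  assumes "f \<in> bilinear_maps K M N P" "g \<in> bilinear_maps K M N P"
    and "\<And>x y. x \<in> carrier M \<Longrightarrow> y \<in> carrier N \<Longrightarrow> f x y = g x y"
  shows "f = g"
proof (rule PiE_ext[OF bilinear_mapsD(1)[OF assms(1)] bilinear_mapsD(1)[OF assms(2)]])
  fix x assume x: "x \<in> carrier M"
  show "f x = g x"
    using PiE_mem[OF bilinear_mapsD(1)[OF assms(1)] x] PiE_mem[OF bilinear_mapsD(1)[OF assms(2)] x]
    by (rule PiE_ext) (rule assms(3)[OF x])
qed

text \<open>Three instances are used: coefficients 1, -1 for the difference of two products, 1, 1
  for a shift by \<beta>, and 1/2, 1/2 for the symmetric part.\<close>

lemma bilinear_maps_lincomb:
  assumes "module K M" "module K N" "module K P"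
    and "f \<in> bilinear_maps K M N P" "g \<in> bilinear_maps K M N P"
    and "a \<in> carrier K" "b \<in> carrier K"
  shows "(\<lambda>x\<in>carrier M. \<lambda>y\<in>carrier N. a \<odot>\<^bsub>P\<^esub> f x y \<oplus>\<^bsub>P\<^esub> b \<odot>\<^bsub>P\<^esub> g x y)
    \<in> bilinear_maps K M N P"
proof -
  interpret M: module K M by fact
  interpret N: module K N by fact
  interpret P: module K P by fact
  note f = bilinear_mapsD(2-)[OF assms(4)] and g = bilinear_mapsD(2-)[OF assms(5)]
  \<comment> \<open>Homogeneity in either argument moves \<open>r\<close> past \<open>a\<close> and
    \<open>b\<close>, which rests on commutativity of \<open>K\<close>.\<close>
  have scal: "a \<odot>\<^bsub>P\<^esub> (r \<odot>\<^bsub>P\<^esub> x) \<oplus>\<^bsub>P\<^esub> b \<odot>\<^bsub>P\<^esub> (r \<odot>\<^bsub>P\<^esub> y) =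
      r \<odot>\<^bsub>P\<^esub> (a \<odot>\<^bsub>P\<^esub> x \<oplus>\<^bsub>P\<^esub> b \<odot>\<^bsub>P\<^esub> y)"
    if "r \<in> carrier K" "x \<in> carrier P" "y \<in> carrier P" for r x y
    using that assms by (simp add: P.smult_r_distr P.smult_assoc1[symmetric] M.R.m_comm)
  show ?thesis
    unfolding bilinear_maps_def module_hom_def
    using assms(6,7) by (auto simp: f g scal P.smult_r_distr P.M.a_ac)
qed

lemma bilinear_maps_flip:
  assumes "f \<in> bilinear_maps K M N P" "module K M" "module K N"
  shows "(\<lambda>y\<in>carrier N. \<lambda>x\<in>carrier M. f x y) \<in> bilinear_maps K N M P"
proof -
  interpret M: module K M by fact
  interpret N: module K N by fact
  note f = bilinear_mapsD(2-)[OF assms(1)]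
  show ?thesis
    unfolding bilinear_maps_def module_hom_def by (auto simp: f)
qed

text \<open>Expanding the value at the sum leaves the two mixed terms next to the two diagonal ones.
  Hence products with equal diagonals have equal symmetrized sums.\<close>

lemma bilinear_polarization:
  assumes "module K M" "module K P" "f \<in> bilinear_maps K M M P"
    and "u \<in> carrier M" "v \<in> carrier M"
  shows "f u v \<oplus>\<^bsub>P\<^esub> f v u = f (u \<oplus>\<^bsub>M\<^esub> v) (u \<oplus>\<^bsub>M\<^esub> v) \<ominus>\<^bsub>P\<^esub> (f u u \<oplus>\<^bsub>P\<^esub> f v v)"
proof -
  interpret M: module K M by fact
  interpret P: module K P by fact
  note f = bilinear_mapsD(2-)[OF assms(3)]
  have "f (u \<oplus>\<^bsub>M\<^esub> v) (u \<oplus>\<^bsub>M\<^esub> v) = (f u v \<oplus>\<^bsub>P\<^esub> f v u) \<oplus>\<^bsub>P\<^esub> (f u u \<oplus>\<^bsub>P\<^esub> f v v)"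
    using assms(4,5) by (simp add: f P.M.a_ac)
  then show ?thesis
    using assms(4,5) by (simp add: f P.M.minus_eq P.M.a_assoc P.M.r_neg)
qed

section \<open>Enhanced Leibniz algebras with a fixed quadratic map\<close>

lemma is_ELA_D:
  assumes "is_ELA K A"
  shows "module K (vsp A)" "module K (wsp A)"
    "tmap A \<in> linear_maps K (wsp A) (vsp A)"
    "brk A \<in> bilinear_maps K (vsp A) (vsp A) (vsp A)"
    "circ A \<in> bilinear_maps K (vsp A) (vsp A) (wsp A)"
  using assms by (auto simp: is_ELA_def leibniz_algebra_def vectorspace_def)

text \<open>Axioms (b) and (d) see only diagonal values of the product, and (c) sees only its
  symmetric part, which polarization recovers from the diagonal.\<close>

lemma is_ELA_circ_update:
  assumes A: "is_ELA K A" and c: "c \<in> bilinear_maps K (vsp A) (vsp A) (wsp A)"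
    and diag: "\<And>v. v \<in> carrier (vsp A) \<Longrightarrow> c v v = circ A v v"
  shows "is_ELA K (A\<lparr>circ := c\<rparr>)"
proof -
  note D = is_ELA_D[OF A]
  interpret V: module K "vsp A" by (fact D)
  note cl = linear_mapsD(3)[OF D(3)] bilinear_mapsD(2)[OF D(4)] bilinear_mapsD(2)[OF D(5)]
  have sym: "circ_sym K (A\<lparr>circ := c\<rparr>) u v = circ_sym K A u v"
    if "u \<in> carrier (vsp A)" "v \<in> carrier (vsp A)" for u v
    using bilinear_polarization[OF D(1,2) c that] bilinear_polarization[OF D(1,2,5) that] that
    by (simp add: circ_sym_def diag)
  show ?thesis
    using A c by (auto simp: is_ELA_def cl sym diag)
qed

text \<open>The difference of two bilinear products with the same diagonal is alternating, so it is
  the \<beta> that turns one product into the other.\<close>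

lemma circ_update_in_ELeib_morphisms:
  assumes A: "is_ELA K A" and c: "c \<in> bilinear_maps K (vsp A) (vsp A) (wsp A)"
    and diag: "\<And>v. v \<in> carrier (vsp A) \<Longrightarrow> c v v = circ A v v"
  shows "\<lparr>src = A, tgt = A\<lparr>circ := c\<rparr>, wmap = (\<lambda>w\<in>carrier (wsp A). w),
    vmap = (\<lambda>v\<in>carrier (vsp A). v)\<rparr> \<in> ELeib_morphisms K"
proof -
  note D = is_ELA_D[OF A]
  interpret V: module K "vsp A" by (fact D)
  interpret W: module K "wsp A" by (fact D)
  note cc = bilinear_mapsD(2)[OF c] and ca = bilinear_mapsD(2)[OF D(5)]
  \<comment> \<open>The difference is spelled with coefficients 1 and -1 to match
    \<open>bilinear_maps_lincomb\<close>.\<close>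
  define \<beta> where "\<beta> = (\<lambda>x\<in>carrier (vsp A). \<lambda>y\<in>carrier (vsp A).
    \<one>\<^bsub>K\<^esub> \<odot>\<^bsub>wsp A\<^esub> c x y \<oplus>\<^bsub>wsp A\<^esub> (\<ominus>\<^bsub>K\<^esub> \<one>\<^bsub>K\<^esub>) \<odot>\<^bsub>wsp A\<^esub> circ A x y)"
  have \<beta>: "\<beta> x y = c x y \<ominus>\<^bsub>wsp A\<^esub> circ A x y"
    if "x \<in> carrier (vsp A)" "y \<in> carrier (vsp A)" for x y
    using that by (simp add: \<beta>_def cc ca W.smult_l_minus W.M.minus_eq)
  have "\<beta> \<in> bilinear_maps K (vsp A) (vsp A) (wsp A)"
    unfolding \<beta>_def by (rule bilinear_maps_lincomb[OF D(1,1,2) c D(5)]) auto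
  then have alt: "\<beta> \<in> alternating_maps K (vsp A) (wsp A)"
    by (simp add: alternating_maps_def \<beta> diag ca W.M.minus_eq W.M.r_neg)
  have "circ A x y \<oplus>\<^bsub>wsp A\<^esub> \<beta> x y = c x y"
    if "x \<in> carrier (vsp A)" "y \<in> carrier (vsp A)" for x y
    using that by (simp add: \<beta> W.M.minus_eq cc ca W.M.a_ac W.M.r_neg)
  then have "(\<lambda>u\<in>carrier (vsp A). \<lambda>v\<in>carrier (vsp A). circ A u v \<oplus>\<^bsub>wsp A\<^esub> \<beta> u v) =
      (\<lambda>u\<in>carrier (vsp A). \<lambda>v\<in>carrier (vsp A). c u v)"
    by (auto intro!: restrict_ext)
  \<comment> \<open>Targets are compared as records, so equality is required off the carriers too;
    there \<open>c\<close> is \<open>undefined\<close> by extensionality, exactly like its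
    restriction.\<close>
  also have "\<dots> = c"
    using bilinear_mapsD(1)[OF c]
    by (auto simp: fun_eq_iff restrict_def PiE_def extensional_def Pi_def)
  finally have "beta_target A \<beta> = A\<lparr>circ := c\<rparr>"
    by (simp add: beta_target_def)
  then show ?thesis
    using ELeib_morphisms.beta[OF A alt] by (simp add: beta_transformation_def)
qed

text \<open>An alternating \<beta> vanishes on the diagonal, so the shift is a change of product
  with fixed quadratic map.\<close>

lemma is_ELA_beta_target:
  assumes A: "is_ELA K A" and \<beta>: "\<beta> \<in> alternating_maps K (vsp A) (wsp A)"
  shows "is_ELA K (beta_target A \<beta>)"
    and "\<And>v. v \<in> carrier (vsp A) \<Longrightarrow> circ (beta_target A \<beta>) v v = circ A v v"
proof -
  note D = is_ELA_D[OF A]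
  interpret W: module K "wsp A" by (fact D)
  have \<beta>b: "\<beta> \<in> bilinear_maps K (vsp A) (vsp A) (wsp A)"
    using \<beta> by (simp add: alternating_maps_def)
  note ca = bilinear_mapsD(2)[OF D(5)] and cb = bilinear_mapsD(2)[OF \<beta>b]
  let ?c = "\<lambda>u\<in>carrier (vsp A). \<lambda>v\<in>carrier (vsp A). circ A u v \<oplus>\<^bsub>wsp A\<^esub> \<beta> u v"
  have "(\<lambda>u\<in>carrier (vsp A). \<lambda>v\<in>carrier (vsp A).
      \<one>\<^bsub>K\<^esub> \<odot>\<^bsub>wsp A\<^esub> circ A u v \<oplus>\<^bsub>wsp A\<^esub> \<one>\<^bsub>K\<^esub> \<odot>\<^bsub>wsp A\<^esub> \<beta> u v) = ?c"
    by (intro restrict_ext) (simp add: ca cb)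
  then have c: "?c \<in> bilinear_maps K (vsp A) (vsp A) (wsp A)"
    using bilinear_maps_lincomb[OF D(1,1,2,5) \<beta>b W.R.one_closed W.R.one_closed] by simp
  have diag: "?c v v = circ A v v" if "v \<in> carrier (vsp A)" for v
    using \<beta> that by (simp add: alternating_maps_def ca)
  show "is_ELA K (beta_target A \<beta>)"
    unfolding beta_target_def by (rule is_ELA_circ_update[OF A c diag])
  show "circ (beta_target A \<beta>) v v = circ A v v" if "v \<in> carrier (vsp A)" for v
    using diag[OF that] by (simp add: beta_target_def)
qed

text \<open>Weakens plain morphisms by asking compatibility with the product on the diagonal only.
  This is the invariant that survives \<beta>-transformations and composition.\<close>

definition quadratic_morphism :: "('k, 'm) ring_scheme \<Rightarrow> ('k, 'w, 'v) ela_mor \<Rightarrow> bool" where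
  "quadratic_morphism K f \<longleftrightarrow>
     is_ELA K (src f) \<and> is_ELA K (tgt f) \<and>
     wmap f \<in> linear_maps K (wsp (src f)) (wsp (tgt f)) \<and>
     vmap f \<in> linear_maps K (vsp (src f)) (vsp (tgt f)) \<and>
     (\<forall>w\<in>carrier (wsp (src f)). vmap f (tmap (src f) w) = tmap (tgt f) (wmap f w)) \<and>
     (\<forall>u\<in>carrier (vsp (src f)). \<forall>v\<in>carrier (vsp (src f)).
        vmap f (brk (src f) u v) = brk (tgt f) (vmap f u) (vmap f v)) \<and>
     (\<forall>v\<in>carrier (vsp (src f)).
        circ (tgt f) (vmap f v) (vmap f v) = wmap f (circ (src f) v v))"

section \<open>Identities and composites of plain and quadratic morphisms\<close>

lemma plain_imp_quadratic_morphism: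
  "is_plain_morphism K f \<Longrightarrow> quadratic_morphism K f"
  by (simp add: is_plain_morphism_def quadratic_morphism_def Let_def)

lemma plain_morphism_id:
  assumes A: "is_ELA K A"
  shows "is_plain_morphism K (ela_id A)"
proof -
  note D = is_ELA_D[OF A]
  note cl = linear_mapsD(3)[OF D(3)] bilinear_mapsD(2)[OF D(4)] bilinear_mapsD(2)[OF D(5)]
  show ?thesis
    using A by (simp add: is_plain_morphism_def ela_id_def Let_def linear_maps_id D cl)
qed

lemma quadratic_morphism_comp:
  assumes "quadratic_morphism K f" "quadratic_morphism K g" "src g = tgt f"
  shows "quadratic_morphism K (ela_comp g f)"
proof -
  have A: "is_ELA K (src f)"
    and wf: "wmap f \<in> linear_maps K (wsp (src f)) (wsp (tgt f))"
    and vf: "vmap f \<in> linear_maps K (vsp (src f)) (vsp (tgt f))"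
    and wg: "wmap g \<in> linear_maps K (wsp (tgt f)) (wsp (tgt g))"
    and vg: "vmap g \<in> linear_maps K (vsp (tgt f)) (vsp (tgt g))"
    using assms by (auto simp: quadratic_morphism_def)
  note D = is_ELA_D[OF A]
  note cl = linear_mapsD(3)[OF D(3)] bilinear_mapsD(2)[OF D(4)] bilinear_mapsD(2)[OF D(5)]
    linear_mapsD(3)[OF wf] linear_mapsD(3)[OF vf]
  show ?thesis
    using assms linear_maps_compose[OF D(2) wf wg] linear_maps_compose[OF D(1) vf vg]
    by (simp add: quadratic_morphism_def ela_comp_def compose_def cl)
qed

lemma plain_morphism_comp:
  assumes "is_plain_morphism K f" "is_plain_morphism K g" "src g = tgt f"
  shows "is_plain_morphism K (ela_comp g f)"
proof -
  \<comment> \<open>This settles every condition except compatibility with products of two distinct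
    vectors.\<close>
  have "quadratic_morphism K (ela_comp g f)"
    using assms by (simp add: plain_imp_quadratic_morphism quadratic_morphism_comp)
  moreover have "is_ELA K (src f)"
    and vf: "vmap f \<in> linear_maps K (vsp (src f)) (vsp (tgt f))"
    using assms(1) by (auto simp: is_plain_morphism_def Let_def)
  moreover note linear_mapsD(3)[OF vf] bilinear_mapsD(2)[OF is_ELA_D(5)[OF \<open>is_ELA K (src f)\<close>]]
  ultimately show ?thesis
    using assms
    by (simp add: is_plain_morphism_def quadratic_morphism_def Let_def ela_comp_def compose_def)
qed

lemma ELeib_morphisms_quadratic:
  "f \<in> ELeib_morphisms K \<Longrightarrow> quadratic_morphism K f"
proof (induction rule: ELeib_morphisms.induct)
  case (plain f)
  then show ?case by (rule plain_imp_quadratic_morphism)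
next
  case (beta A \<beta>)
  \<comment> \<open>A \<beta>-transformation has the same underlying maps as
    \<open>ela_id A\<close>, and its target differs from \<open>A\<close> only in the product, whose
    diagonal is unchanged.\<close>
  have "quadratic_morphism K (ela_id A)"
    by (simp add: beta plain_imp_quadratic_morphism plain_morphism_id)
  then show ?case
    using is_ELA_beta_target[OF beta]
    by (simp add: quadratic_morphism_def beta_transformation_def ela_id_def)
      (simp add: beta_target_def)
next
  case (comp f g)
  then show ?case by (simp add: quadratic_morphism_comp)
qed

section \<open>The two categories\<close>

lemma quadratic_morphism_is_ELA:
  assumes "quadratic_morphism K f"
  shows "is_ELA K (src f)" "is_ELA K (tgt f)"
  using assms by (simp_all add: quadratic_morphism_def)

lemma quadratic_morphism_maps:
  assumes "quadratic_morphism K f"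
  shows "wmap f \<in> carrier (wsp (src f)) \<rightarrow> carrier (wsp (tgt f))"
    "vmap f \<in> carrier (vsp (src f)) \<rightarrow> carrier (vsp (tgt f))"
    "wmap f \<in> extensional (carrier (wsp (src f)))"
    "vmap f \<in> extensional (carrier (vsp (src f)))"
  using assms by (auto simp: quadratic_morphism_def dest: linear_mapsD)

text \<open>\<open>compose\<close> restricts to the carrier of the source, so the unit laws hold as
  equations of functions because the maps of \<open>f\<close> are extensional.\<close>

lemma ela_comp_id:
  assumes "quadratic_morphism K f"
  shows "ela_comp f (ela_id (src f)) = f" "ela_comp (ela_id (tgt f)) f = f"
  using quadratic_morphism_maps[OF assms]
  by (auto simp: ela_comp_def ela_id_def compose_Id Id_compose intro!: ela_mor.equality)

lemma ela_comp_assoc: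
  assumes "quadratic_morphism K f" "src g = tgt f"
  shows "ela_comp h (ela_comp g f) = ela_comp (ela_comp h g) f"
  using quadratic_morphism_maps[OF assms(1)] assms(2)
  by (auto simp: ela_comp_def intro!: compose_assoc)

lemma src_tgt_simps [simp]:
  "src (ela_id A) = A" "tgt (ela_id A) = A"
  "src (ela_comp g f) = src f" "tgt (ela_comp g f) = tgt g"
  by (simp_all add: ela_id_def ela_comp_def)

lemma is_category_ELeib:
  fixes K :: "('k, 'm) ring_scheme"
  shows "is_category (ELeib K :: (('k, 'w, 'v) ela_data, ('k, 'w, 'v) ela_mor) cat)"
proof -
  have id: "ela_id A \<in> ELeib_morphisms K" if "is_ELA K A" for A :: "('k, 'w, 'v) ela_data"
    using that by (intro ELeib_morphisms.plain plain_morphism_id)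
  have "is_ELA K (src f)" "is_ELA K (tgt f)"
    "ela_comp f (ela_id (src f)) = f" "ela_comp (ela_id (tgt f)) f = f"
    "\<And>g h. src g = tgt f \<Longrightarrow> ela_comp h (ela_comp g f) = ela_comp (ela_comp h g) f"
    if "f \<in> ELeib_morphisms K" for f :: "('k, 'w, 'v) ela_mor"
    using ELeib_morphisms_quadratic[OF that] ela_comp_id ela_comp_assoc
    by (auto simp: quadratic_morphism_is_ELA)
  with id show ?thesis
    unfolding is_category_def in_hom_def ELeib_def by (simp add: ELeib_morphisms.comp)
qed

lemma is_category_sELeib:
  fixes K :: "('k, 'm) ring_scheme"
  shows "is_category (sELeib K :: (('k, 'w, 'v) ela_data, ('k, 'w, 'v) ela_mor) cat)"
proof -
  have "ela_comp f (ela_id (src f)) = f" "ela_comp (ela_id (tgt f)) f = f"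
    "\<And>g h. src g = tgt f \<Longrightarrow> ela_comp h (ela_comp g f) = ela_comp (ela_comp h g) f"
    if "is_plain_morphism K f" for f :: "('k, 'w, 'v) ela_mor"
    using plain_imp_quadratic_morphism[OF that] ela_comp_id ela_comp_assoc by auto
  moreover have "is_plain_morphism K (ela_id A)" if "is_sELA K A" for A :: "('k, 'w, 'v) ela_data"
    using that by (simp add: is_sELA_def plain_morphism_id)
  ultimately show ?thesis
    unfolding is_category_def in_hom_def sELeib_def by (simp add: plain_morphism_comp)
qed

lemma is_functor_inclusion: "is_functor (sELeib K) (ELeib K) inclusion_functor"
  using is_category_ELeib[of K] is_category_sELeib[of K]
  unfolding is_functor_def inclusion_functor_def in_hom_def
  by (auto simp: ELeib_def sELeib_def is_sELA_def intro: ELeib_morphisms.plain)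

section \<open>Symmetrization\<close>

text \<open>The restriction to the carriers keeps the product extensional, as
  \<open>bilinear_maps\<close> demands.\<close>

definition symmetrize ::
    "('k, 'm) ring_scheme \<Rightarrow> ('k, 'w, 'v) ela_data \<Rightarrow> ('k, 'w, 'v) ela_data" where
  "symmetrize K A =
     A\<lparr>circ := (\<lambda>u\<in>carrier (vsp A). \<lambda>v\<in>carrier (vsp A). circ_sym K A u v)\<rparr>"

lemma symmetrize_simps [simp]:
  "wsp (symmetrize K A) = wsp A" "vsp (symmetrize K A) = vsp A"
  "tmap (symmetrize K A) = tmap A" "brk (symmetrize K A) = brk A"
  "u \<in> carrier (vsp A) \<Longrightarrow> v \<in> carrier (vsp A) \<Longrightarrow>
    circ (symmetrize K A) u v = circ_sym K A u v"
  by (simp_all add: symmetrize_def)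

definition symmetrize_functor ::
    "('k, 'm) ring_scheme \<Rightarrow> (('k, 'w, 'v) ela_data, ('k, 'w, 'v) ela_mor,
      ('k, 'w, 'v) ela_data, ('k, 'w, 'v) ela_mor) func" where
  "symmetrize_functor K = \<lparr>onObj = symmetrize K,
     onArr = (\<lambda>f. f\<lparr>src := symmetrize K (src f), tgt := symmetrize K (tgt f)\<rparr>)\<rparr>"

section \<open>The symmetric part in characteristic different from 2\<close>

locale field_char_not_2 = field K for K :: "('k, 'm) ring_scheme" (structure) +
  assumes two_nonzero: "\<one> \<oplus> \<one> \<noteq> \<zero>"
begin

abbreviation half :: 'k where "half \<equiv> inv (\<one> \<oplus> \<one>)"

lemma half_closed [simp]: "half \<in> carrier K"
  using two_nonzero by (simp add: field_Units)

lemma half_smult_double: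
  assumes "module K W" "x \<in> carrier W"
  shows "half \<odot>\<^bsub>W\<^esub> (x \<oplus>\<^bsub>W\<^esub> x) = x"
proof -
  interpret W: module K W by fact
  have "x \<oplus>\<^bsub>W\<^esub> x = (\<one> \<oplus> \<one>) \<odot>\<^bsub>W\<^esub> x"
    using assms(2) by (simp add: W.smult_l_distr)
  then show ?thesis
    using assms(2) two_nonzero by (simp add: W.smult_assoc1[symmetric] field_Units)
qed

lemma circ_sym_commute:
  assumes "is_ELA K A" "u \<in> carrier (vsp A)" "v \<in> carrier (vsp A)"
  shows "circ_sym K A u v = circ_sym K A v u"
proof -
  note D = is_ELA_D[OF assms(1)]
  interpret W: module K "wsp A" by (fact D)
  show ?thesis
    using assms(2,3) bilinear_mapsD(2)[OF D(5)] by (simp add: circ_sym_def W.M.a_comm)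
qed

text \<open>Half of a doubled vector is the vector. The case \<open>u = v\<close>, where the last
  premise is trivial, shows that symmetrization fixes the quadratic map.\<close>

lemma circ_sym_of_commute:
  assumes "is_ELA K A" "u \<in> carrier (vsp A)" "v \<in> carrier (vsp A)" "circ A u v = circ A v u"
  shows "circ_sym K A u v = circ A u v"
proof -
  note D = is_ELA_D[OF assms(1)]
  show ?thesis
    unfolding circ_sym_def assms(4)[symmetric]
    by (rule half_smult_double[OF D(2) bilinear_mapsD(2)[OF D(5) assms(2,3)]])
qed

lemma circ_sym_bilinear:
  assumes "is_ELA K A"
  shows "(\<lambda>u\<in>carrier (vsp A). \<lambda>v\<in>carrier (vsp A). circ_sym K A u v)
    \<in> bilinear_maps K (vsp A) (vsp A) (wsp A)"
proof -
  note D = is_ELA_D[OF assms]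
  interpret W: module K "wsp A" by (fact D)
  note ca = bilinear_mapsD(2)[OF D(5)]
  let ?flip = "\<lambda>v\<in>carrier (vsp A). \<lambda>u\<in>carrier (vsp A). circ A u v"
  \<comment> \<open>Distributing the scalar exhibits the symmetric part as a linear combination of
    the product and its flip.\<close>
  have "(\<lambda>u\<in>carrier (vsp A). \<lambda>v\<in>carrier (vsp A). circ_sym K A u v) =
      (\<lambda>u\<in>carrier (vsp A). \<lambda>v\<in>carrier (vsp A).
        half \<odot>\<^bsub>wsp A\<^esub> circ A u v \<oplus>\<^bsub>wsp A\<^esub> half \<odot>\<^bsub>wsp A\<^esub> ?flip u v)"
    by (intro restrict_ext) (simp add: circ_sym_def W.smult_r_distr ca)
  then show ?thesis
    using bilinear_maps_lincomb[OF D(1,1,2,5) bilinear_maps_flip[OF D(5,1,1)] half_closed half_closed]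
    by simp
qed

lemma is_sELA_symmetrize:
  assumes "is_ELA K A"
  shows "is_sELA K (symmetrize K A)"
proof -
  have "is_ELA K (symmetrize K A)"
    unfolding symmetrize_def
    by (rule is_ELA_circ_update[OF assms circ_sym_bilinear[OF assms]])
      (simp add: circ_sym_of_commute assms)
  then show ?thesis
    by (simp add: is_sELA_def circ_sym_commute[OF assms])
qed

text \<open>Both products are extensional and agree on the carriers, so the records are equal, not
  just isomorphic; symmetrization is thus strictly the identity on \<open>sELeib\<close>.\<close>

lemma symmetrize_is_sELA:
  assumes "is_sELA K A"
  shows "symmetrize K A = A"
proof -
  have A: "is_ELA K A" using assms by (simp add: is_sELA_def)
  have "(\<lambda>u\<in>carrier (vsp A). \<lambda>v\<in>carrier (vsp A). circ_sym K A u v) = circ A"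
  proof (rule bilinear_maps_eqI[OF circ_sym_bilinear[OF A] is_ELA_D(5)[OF A]])
    fix u v assume uv: "u \<in> carrier (vsp A)" "v \<in> carrier (vsp A)"
    then have "circ A u v = circ A v u" using assms by (simp add: is_sELA_def)
    with uv show "(\<lambda>u\<in>carrier (vsp A). \<lambda>v\<in>carrier (vsp A). circ_sym K A u v) u v = circ A u v"
      using circ_sym_of_commute[OF A uv] by simp
  qed
  then show ?thesis by (simp add: symmetrize_def)
qed

text \<open>Polarization writes both symmetric parts through diagonal values, and these are carried
  to each other by the linear maps of \<open>f\<close>.\<close>

lemma quadratic_morphism_circ_sym:
  assumes "quadratic_morphism K f" "u \<in> carrier (vsp (src f))" "v \<in> carrier (vsp (src f))"
  shows "circ_sym K (tgt f) (vmap f u) (vmap f v) = wmap f (circ_sym K (src f) u v)"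
proof -
  have w: "wmap f \<in> linear_maps K (wsp (src f)) (wsp (tgt f))"
    and v: "vmap f \<in> linear_maps K (vsp (src f)) (vsp (tgt f))"
    and q: "\<And>x. x \<in> carrier (vsp (src f)) \<Longrightarrow>
      circ (tgt f) (vmap f x) (vmap f x) = wmap f (circ (src f) x x)"
    using assms(1) by (auto simp: quadratic_morphism_def)
  note S = is_ELA_D[OF quadratic_morphism_is_ELA(1)[OF assms(1)]]
    and T = is_ELA_D[OF quadratic_morphism_is_ELA(2)[OF assms(1)]]
  interpret V: module K "vsp (src f)" by (fact S)
  interpret W: module K "wsp (src f)" by (fact S)
  interpret W': module K "wsp (tgt f)" by (fact T)
  note cs = bilinear_mapsD(2)[OF S(5)] and ws = linear_mapsD(3-)[OF w]
    and vs = linear_mapsD(3-)[OF v]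
  \<comment> \<open>Polarization involves subtraction; linearity yields it by taking -1 as the
    scalar.\<close>
  have uminus: "wmap f (\<ominus>\<^bsub>wsp (src f)\<^esub> x) = \<ominus>\<^bsub>wsp (tgt f)\<^esub> wmap f x"
    if "x \<in> carrier (wsp (src f))" for x
    using ws(3)[of "\<ominus> \<one>" x] that by (simp add: W.smult_l_minus W'.smult_l_minus ws)
  \<comment> \<open>Additivity of \<open>vmap f\<close> is read from right to left: the sum of the
    images becomes the image of \<open>u + v\<close>, where \<open>q\<close> applies.\<close>
  show ?thesis
    using assms(2,3) bilinear_polarization[OF S(1,2,5) assms(2,3)]
      bilinear_polarization[OF T(1,2,5) vs(1)[OF assms(2)] vs(1)[OF assms(3)]]
    by (simp add: circ_sym_def vs(2)[symmetric] q ws cs W.M.minus_eq W'.M.minus_eq uminus)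
qed

text \<open>The products of the symmetrized algebras are the symmetric parts, so
  \<open>quadratic_morphism_circ_sym\<close> is precisely the missing condition on arbitrary
  pairs.\<close>

lemma plain_morphism_symmetrize:
  assumes "quadratic_morphism K f"
  shows "is_plain_morphism K (onArr (symmetrize_functor K) f)"
proof -
  have v: "vmap f \<in> linear_maps K (vsp (src f)) (vsp (tgt f))"
    using assms by (simp add: quadratic_morphism_def)
  have "is_ELA K (symmetrize K (src f))" "is_ELA K (symmetrize K (tgt f))"
    using assms is_sELA_symmetrize by (auto simp: quadratic_morphism_def is_sELA_def)
  then show ?thesis
    using assms
    by (simp add: symmetrize_functor_def is_plain_morphism_def Let_def linear_mapsD(3)[OF v]
        quadratic_morphism_circ_sym) (simp add: quadratic_morphism_def)
qed

text \<open>The underlying pair of maps is kept, so identities and composites are respected at once;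
  the substance is that images are plain and symmetric.\<close>

lemma is_functor_symmetrize:
  "is_functor (ELeib K :: (('k, 'w, 'v) ela_data, ('k, 'w, 'v) ela_mor) cat) (sELeib K)
    (symmetrize_functor K)"
proof -
  have "is_sELA K (symmetrize K (src f))" "is_sELA K (symmetrize K (tgt f))"
    "is_plain_morphism K (f\<lparr>src := symmetrize K (src f), tgt := symmetrize K (tgt f)\<rparr>)"
    if "f \<in> ELeib_morphisms K" for f :: "('k, 'w, 'v) ela_mor"
    using plain_morphism_symmetrize[OF ELeib_morphisms_quadratic[OF that]]
    by (simp_all add: symmetrize_functor_def is_sELA_symmetrize
        quadratic_morphism_is_ELA[OF ELeib_morphisms_quadratic[OF that]])
  then show ?thesis
    using is_category_ELeib[of K] is_category_sELeib[of K]
    unfolding is_functor_def in_hom_def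
    by (auto simp: ELeib_def sELeib_def symmetrize_functor_def ela_id_def ela_comp_def
        is_sELA_symmetrize)
qed

section \<open>The two natural isomorphisms\<close>

lemma sELeib_unit:
  "naturally_isomorphic (sELeib K :: (('k, 'w, 'v) ela_data, ('k, 'w, 'v) ela_mor) cat) (sELeib K)
    (func_comp (symmetrize_functor K) inclusion_functor) func_id"
    (is "naturally_isomorphic ?C _ ?GF _")
proof -
  \<comment> \<open>On the objects and arrows of \<open>sELeib\<close> the round trip changes
    nothing, so identities can serve as components of the unit.\<close>
  have obj: "onObj ?GF A = A" if "A \<in> Obj ?C" for A
    using that
    by (simp add: func_comp_def symmetrize_functor_def inclusion_functor_def sELeib_def
        symmetrize_is_sELA)
  have arr: "onArr ?GF f = f" if "f \<in> Arr ?C" for f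
    using that
    by (simp add: func_comp_def symmetrize_functor_def inclusion_functor_def sELeib_def
        symmetrize_is_sELA)
  have cat: "is_category ?C" by (rule is_category_sELeib)
  have id: "is_functor ?C ?C func_id"
    using cat by (auto simp: is_functor_def func_id_def is_category_def in_hom_def)
  have GF: "is_functor ?C ?C ?GF"
    using cat by (auto simp: is_functor_def is_category_def in_hom_def obj arr)
  have "natural_transformation ?C ?C ?GF func_id (Idt ?C)"
    using cat id GF
    by (auto simp: natural_transformation_def is_category_def in_hom_def obj arr func_id_def)
  moreover have "\<forall>A\<in>Obj ?C. is_iso ?C (Idt ?C A)"
    using cat unfolding is_iso_def is_category_def in_hom_def by metis
  ultimately show ?thesis unfolding naturally_isomorphic_def by blast
qed

text \<open>Component of the counit at \<open>A\<close>: the \<beta>-transformation given by the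
  product minus its symmetric part. Symmetrizing keeps both spaces, so the identity maps of
  \<open>ela_id A\<close> fit.\<close>

definition from_symmetrize :: "('k, 'w, 'v) ela_data \<Rightarrow> ('k, 'w, 'v) ela_mor" where
  "from_symmetrize A = (ela_id A)\<lparr>src := symmetrize K A\<rparr>"

definition to_symmetrize :: "('k, 'w, 'v) ela_data \<Rightarrow> ('k, 'w, 'v) ela_mor" where
  "to_symmetrize A = (ela_id A)\<lparr>tgt := symmetrize K A\<rparr>"

lemma to_symmetrize_in_ELeib_morphisms:
  assumes "is_ELA K A"
  shows "to_symmetrize A \<in> ELeib_morphisms K"
  using circ_update_in_ELeib_morphisms[OF assms circ_sym_bilinear[OF assms]]
  by (simp add: to_symmetrize_def ela_id_def symmetrize_def circ_sym_of_commute assms)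

lemma from_symmetrize_in_ELeib_morphisms:
  assumes "is_ELA K A"
  shows "from_symmetrize A \<in> ELeib_morphisms K"
proof -
  have S: "is_ELA K (symmetrize K A)"
    using is_sELA_symmetrize[OF assms] by (simp add: is_sELA_def)
  \<comment> \<open>Symmetrizing alters the product alone; restoring the original product turns the
    change of product into an arrow back to \<open>A\<close>.\<close>
  have circ_update: "(symmetrize K A)\<lparr>circ := circ A\<rparr> = A"
    by (simp add: symmetrize_def)
  show ?thesis
    using circ_update_in_ELeib_morphisms[OF S, of "circ A"] is_ELA_D(5)[OF assms]
    by (simp add: from_symmetrize_def ela_id_def circ_sym_of_commute assms circ_update)
qed

lemma is_iso_from_symmetrize:
  assumes "is_ELA K A"
  shows "is_iso (ELeib K) (from_symmetrize A)"
proof -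
  have "ela_comp (to_symmetrize A) (from_symmetrize A) = ela_id (symmetrize K A)"
    "ela_comp (from_symmetrize A) (to_symmetrize A) = ela_id A"
    by (auto simp: to_symmetrize_def from_symmetrize_def ela_comp_def ela_id_def compose_def
        intro!: restrict_ext)
  then show ?thesis
    using from_symmetrize_in_ELeib_morphisms[OF assms] to_symmetrize_in_ELeib_morphisms[OF assms]
    unfolding is_iso_def in_hom_def
    by (auto simp: ELeib_def to_symmetrize_def from_symmetrize_def intro!: exI[of _ "to_symmetrize A"])
qed

lemma ELeib_counit:
  "naturally_isomorphic (ELeib K :: (('k, 'w, 'v) ela_data, ('k, 'w, 'v) ela_mor) cat) (ELeib K)
    (func_comp inclusion_functor (symmetrize_functor K)) func_id"
    (is "naturally_isomorphic ?D _ ?FG _")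
proof -
  have cat: "is_category ?D" by (rule is_category_ELeib)
  have id: "is_functor ?D ?D func_id"
    using cat by (auto simp: is_functor_def func_id_def is_category_def in_hom_def)
  \<comment> \<open>\<open>Dom\<close>, \<open>Cod\<close>, \<open>Idt\<close> and
    \<open>Cmp\<close> are the same in both categories, so the functor laws of symmetrization
    transfer to \<open>ELeib\<close>.\<close>
  have FG: "is_functor ?D ?D ?FG"
    using is_functor_symmetrize is_functor_inclusion[of K]
    by (auto simp: is_functor_def func_comp_def inclusion_functor_def in_hom_def sELeib_def
        ELeib_def)
  have hom: "in_hom ?D (from_symmetrize A) (symmetrize K A) A" if "is_ELA K A" for A
    using from_symmetrize_in_ELeib_morphisms[OF that]
    by (simp add: in_hom_def ELeib_def from_symmetrize_def)
  \<comment> \<open>Both paths run from \<open>symmetrize K (src f)\<close> to \<open>tgt f\<close>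
    and have the underlying pair of \<open>f\<close>, since the components are identities on the
    spaces.\<close>
  have nat: "ela_comp (from_symmetrize (tgt f)) (onArr (symmetrize_functor K) f) =
      ela_comp f (from_symmetrize (src f))"
    if "f \<in> ELeib_morphisms K" for f :: "('k, 'w, 'v) ela_mor"
    using quadratic_morphism_maps[OF ELeib_morphisms_quadratic[OF that]]
    by (auto simp: ela_comp_def from_symmetrize_def ela_id_def symmetrize_functor_def
        compose_Id Id_compose)
  have "natural_transformation ?D ?D ?FG func_id from_symmetrize"
    unfolding natural_transformation_def using id FG hom nat
    by (simp add: func_comp_def inclusion_functor_def func_id_def)
      (simp add: ELeib_def symmetrize_functor_def)
  moreover have "\<forall>A\<in>Obj ?D. is_iso ?D (from_symmetrize A)"
    by (simp add: ELeib_def is_iso_from_symmetrize[unfolded ELeib_def])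
  ultimately show ?thesis unfolding naturally_isomorphic_def by blast
qed

end

theorem proposition1p13:
  fixes K :: "('k, 'm) ring_scheme"
  assumes "field K"
    and "\<one>\<^bsub>K\<^esub> \<oplus>\<^bsub>K\<^esub> \<one>\<^bsub>K\<^esub> \<noteq> \<zero>\<^bsub>K\<^esub>"
  shows "is_equivalence
    (sELeib K :: (('k, 'w, 'v) ela_data, ('k, 'w, 'v) ela_mor) cat)
    (ELeib K :: (('k, 'w, 'v) ela_data, ('k, 'w, 'v) ela_mor) cat)
    inclusion_functor"
proof -
  interpret field_char_not_2 K
    using assms by (simp add: field_char_not_2_def field_char_not_2_axioms_def)
  show ?thesis
    unfolding is_equivalence_def
    using is_functor_inclusion is_functor_symmetrize sELeib_unit ELeib_counit by blast
qed

end
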